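(* Let $\mathcal{R}$ be an associative ring with unit $1\neq 0$, let $a,x\in\mathcal{R}$ and let $\mathcal{S},\mathcal{T}$ be right ideals of $\mathcal{R}$. Then the following assertions are equivalent: (1) $x\in a\{1\}$, $xa\mathcal{R}=\mathcal{S}$, and ${\rm rann}(ax)=\mathcal{T}$. (2) $\varphi_{ax}=\rho_{a\mathcal{R},\mathcal{T}}$ and $\varphi_{xa}=\rho_{\mathcal{S},\,{\rm rann}(a)}$. (3) $x=\rho_{\mathcal{S},\,{\rm rann}(a)}(1)\,a^{(1)}\,\rho_{a\mathcal{R},\mathcal{T}}(1)+(1-a^{(1)}a)\,y\,(1-aa^{(1)})$ for some $a^{(1)}\in a\{1\}$ and some $y\in\mathcal{R}$.
   Context: For $a\in\mathcal{R}$: $a\{1\}=\{x\in\mathcal{R}: axa=a\}$; $a\mathcal{R}=\{ar:r\in\mathcal{R}\}$, ${\rm rann}(a)=\{r\in\mathcal{R}:ar=0\}$; $\varphi_a:\mathcal{R}\to\mathcal{R}$ is the additive group endomorphism $\varphi_a(r)=ar$. For additive subgroups $\mathcal{S},\mathcal{T}$ of $\mathcal{R}$, $\mathcal{R}=\mathcal{S}\oplus\mathcal{T}$ means $\mathcal{R}=\mathcal{S}+\mathcal{T}$ and $\mathcal{S}\cap\mathcal{T}=\{0\}$; in that case $\rho_{\mathcal{S},\mathcal{T}}:\mathcal{R}\to\mathcal{R}$ is the group endomorphism $\rho_{\mathcal{S},\mathcal{T}}(s+t)=s$ for $s\in\mathcal{S}$, $t\in\mathcal{T}$. Convention: whenever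 $\rho_{\mathcal{S},\mathcal{T}}$ is written, it is implicitly asserted that $\mathcal{R}=\mathcal{S}\oplus\mathcal{T}$; thus (2) and (3) each include the assertions $\mathcal{R}=a\mathcal{R}\oplus\mathcal{T}$ and $\mathcal{R}=\mathcal{S}\oplus{\rm rann}(a)$. *)

theory Defs
  imports Main "HOL-Library.Set_Algebras"
begin

text \<open>The ring is the carrier of a type of class \<open>ring_1\<close>: associative, unital, not assumed
  commutative, with \<open>0 \<noteq> 1\<close>.\<close>

definition add_subgroup :: "'a::ring_1 set \<Rightarrow> bool" where
  "add_subgroup S \<longleftrightarrow> 0 \<in> S \<and> (\<forall>s\<in>S. \<forall>t\<in>S. s + t \<in> S) \<and> (\<forall>s\<in>S. - s \<in> S)"

definition right_ideal :: "'a::ring_1 set \<Rightarrow> bool" where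
  "right_ideal S \<longleftrightarrow> add_subgroup S \<and> (\<forall>s\<in>S. \<forall>r. s * r \<in> S)"

definition inner_inverses :: "'a::ring_1 \<Rightarrow> 'a set" where
  "inner_inverses a = {x. a * x * a = a}"

definition image_ideal :: "'a::ring_1 \<Rightarrow> 'a set" where
  "image_ideal a = {a * r | r. True}"

definition rann :: "'a::ring_1 \<Rightarrow> 'a set" where
  "rann a = {r. a * r = 0}"

definition left_mult :: "'a::ring_1 \<Rightarrow> 'a \<Rightarrow> 'a" where
  "left_mult a = (\<lambda>r. a * r)"

text \<open>Here \<open>S + T\<close> is the elementwise sum of sets.\<close>

definition ring_direct_sum :: "'a::ring_1 set \<Rightarrow> 'a set \<Rightarrow> bool" where
  "ring_direct_sum S T \<longleftrightarrow> UNIV = S + T \<and> S \<inter> T = {0}"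

text \<open>The projection onto \<open>S\<close> along \<open>T\<close>. It is meaningful only for additive subgroups with
  \<open>ring_direct_sum S T\<close> (see \<open>proj_along_add\<close> below), which has to be asserted
  wherever the projection is used.\<close>

definition proj_along :: "'a::ring_1 set \<Rightarrow> 'a set \<Rightarrow> 'a \<Rightarrow> 'a" where
  "proj_along S T r = (THE s. s \<in> S \<and> (\<exists>t\<in>T. r = s + t))"

lemma proj_along_add:
  assumes "add_subgroup S" "add_subgroup T" "ring_direct_sum S T" "s \<in> S" "t \<in> T"
  shows "proj_along S T (s + t) = s"
  unfolding proj_along_def
proof (rule the_equality)
  show "s \<in> S \<and> (\<exists>t'\<in>T. s + t = s + t')"
    using assms by blast
next
  fix u assume "u \<in> S \<and> (\<exists>t'\<in>T. s + t = u + t')"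
  then obtain t' where u: "u \<in> S" and t': "t' \<in> T" and eq: "s + t = u + t'"
    by blast
  have "u + - s \<in> S" "t + - t' \<in> T"
    using assms u t' unfolding add_subgroup_def by blast+
  moreover have "u + - s = t + - t'"
    using eq by (simp add: algebra_simps)
  ultimately have "u + - s \<in> S \<inter> T"
    by simp
  then show "u = s"
    using assms(3) unfolding ring_direct_sum_def by simp
qed

lemma right_ideal_image_ideal: "right_ideal (image_ideal a)"
  unfolding right_ideal_def add_subgroup_def image_ideal_def
  by (auto simp: mult.assoc intro: exI[of _ 0])
     (metis distrib_left, metis mult_minus_right)

lemma right_ideal_rann: "right_ideal (rann a)"
  unfolding right_ideal_def add_subgroup_def rann_def
  by (auto simp: distrib_left mult.assoc[symmetric])

end

theory Submission
  imports Defs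
begin

text \<open>
  A decomposition of the ring into two right ideals \<open>S \<oplus> T\<close> is the same thing as an idempotent
  \<open>e\<close>: the projection onto \<open>S\<close> along \<open>T\<close> commutes with right multiplication, so it is left
  multiplication by its value \<open>e\<close> at \<open>1\<close>, and \<open>S = eR\<close>, \<open>T = rann e\<close>
  (\<open>left_mult_eq_proj_along_iff\<close>). Everything reduces to computing with the two idempotents
  \<open>p = \<rho>\<^bsub>S,rann a\<^esub>(1)\<close> and \<open>q = \<rho>\<^bsub>aR,T\<^esub>(1)\<close>.

  An inner inverse \<open>x\<close> of \<open>a\<close> makes \<open>ax\<close> and \<open>xa\<close> idempotent with \<open>axR = aR\<close> and
  \<open>rann (xa) = rann a\<close>. Prescribing the other two ideals, \<open>xaR = S\<close> and \<open>rann (ax) = T\<close>, therefore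
  says exactly that \<open>ax = q\<close> and \<open>xa = p\<close>; conversely \<open>ax = q\<close> gives \<open>axa = qa = a\<close>, because \<open>q\<close>
  fixes \<open>aR\<close>. This is the equivalence of the first two conditions.

  The third condition solves the linear system \<open>ax = q\<close>, \<open>xa = p\<close>. Since \<open>ap = a\<close> and \<open>qa = a\<close>, the
  element \<open>pbq\<close> is a particular solution for every inner inverse \<open>b\<close>
  (\<open>particular_solution_plus_homogeneous\<close>), and the terms \<open>(1 - ba)y(1 - ab)\<close> solve the homogeneous
  system \<open>au = 0 = ua\<close>. Every solution \<open>x\<close> is reached with \<open>b = y = x\<close>, which splits it as
  \<open>x = xax + (x - xax)\<close>.
\<close>

section \<open>Right ideal decompositions and idempotents\<close>

lemma right_ideal_add_subgroup: "right_ideal S \<Longrightarrow> add_subgroup S"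
  unfolding right_ideal_def by blast

lemma self_mem_image_ideal: "a \<in> image_ideal a"
  unfolding image_ideal_def by (simp add: exI[of _ 1])

text \<open>The Peirce decomposition \<open>r = er + (1 - e)r\<close>.\<close>

lemma idempotent_direct_sum:
  fixes e :: "'a::ring_1"
  assumes "e * e = e"
  shows "ring_direct_sum (image_ideal e) (rann e)"
proof -
  have e_absorb: "e * (e * r) = e * r" for r
    by (metis assms mult.assoc)
  have "r \<in> image_ideal e + rann e" for r
  proof -
    have "e * r \<in> image_ideal e"
      unfolding image_ideal_def by blast
    moreover have "r - e * r \<in> rann e"
      unfolding rann_def by (simp add: right_diff_distrib e_absorb)
    moreover have "r = e * r + (r - e * r)"
      by simp
    ultimately show ?thesis
      by (metis set_plus_intro)
  qed
  moreover have "image_ideal e \<inter> rann e = {0}"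
    unfolding image_ideal_def rann_def by (auto simp: e_absorb intro: exI[of _ 0])
  ultimately show ?thesis
    unfolding ring_direct_sum_def by blast
qed

lemma left_mult_eq_proj_alongI:
  fixes e :: "'a::ring_1"
  assumes S: "add_subgroup S" and T: "add_subgroup T" and ST: "ring_direct_sum S T"
    and fixes_S: "\<And>s. s \<in> S \<Longrightarrow> e * s = s" and kills_T: "\<And>t. t \<in> T \<Longrightarrow> e * t = 0"
  shows "left_mult e = proj_along S T"
proof
  fix r :: 'a
  have "r \<in> S + T"
    using ST unfolding ring_direct_sum_def by blast
  then obtain s t where r: "r = s + t" and "s \<in> S" "t \<in> T"
    by (rule set_plus_elim)
  then show "left_mult e r = proj_along S T r"
    by (simp add: left_mult_def r distrib_left fixes_S kills_T proj_along_add[OF S T ST])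
qed

text \<open>Closure of \<open>S\<close> and \<open>T\<close> under right multiplication makes the projection right linear: the
  components of \<open>r\<close> are those of \<open>1\<close> multiplied by \<open>r\<close>.\<close>

lemma proj_along_eq_left_mult:
  fixes S T :: "'a::ring_1 set"
  assumes S: "right_ideal S" and T: "right_ideal T" and ST: "ring_direct_sum S T"
  shows "proj_along S T = left_mult (proj_along S T 1)"
proof
  fix r :: 'a
  note proj = proj_along_add[OF right_ideal_add_subgroup[OF S] right_ideal_add_subgroup[OF T] ST]
  have "(1::'a) \<in> S + T"
    using ST unfolding ring_direct_sum_def by blast
  then obtain s t where one: "1 = s + t" and st: "s \<in> S" "t \<in> T"
    by (rule set_plus_elim)
  have "r = s * r + t * r"
    by (metis one distrib_right mult_1_left)
  moreover have "s * r \<in> S" "t * r \<in> T"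
    using S T st unfolding right_ideal_def by blast+
  ultimately have "proj_along S T r = s * r"
    using proj by metis
  moreover have "proj_along S T 1 = s"
    using proj[OF st] one by simp
  ultimately show "proj_along S T r = left_mult (proj_along S T 1) r"
    by (simp add: left_mult_def)
qed

text \<open>The dictionary between right ideal decompositions and idempotents. A projection is idempotent
  and is determined by its range and its kernel, and every idempotent arises in this way by the
  Peirce decomposition. Equalities of endomorphisms thus become equations and ideal identities for
  the single element \<open>e\<close>.\<close>

lemma left_mult_eq_proj_along_iff:
  fixes e :: "'a::ring_1"
  assumes S: "right_ideal S" and T: "right_ideal T"
  shows "ring_direct_sum S T \<and> left_mult e = proj_along S T \<longleftrightarrow>
    e * e = e \<and> image_ideal e = S \<and> rann e = T"
proof
  assume "ring_direct_sum S T \<and> left_mult e = proj_along S T"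
  then have ST: "ring_direct_sum S T" and e: "left_mult e = proj_along S T"
    by blast+
  note subgroups = right_ideal_add_subgroup[OF S] right_ideal_add_subgroup[OF T]
  have e_add: "e * (s + t) = s" if "s \<in> S" "t \<in> T" for s t
    using proj_along_add[OF subgroups ST that] e by (metis left_mult_def)
  have decomp: "\<exists>s\<in>S. \<exists>t\<in>T. r = s + t" for r :: 'a
  proof -
    have "r \<in> S + T"
      using ST unfolding ring_direct_sum_def by blast
    then show ?thesis
      by (rule set_plus_elim) blast
  qed
  have zero: "0 \<in> S" "0 \<in> T"
    using subgroups unfolding add_subgroup_def by blast+
  have fixes_S: "e * s = s" if "s \<in> S" for s
    using e_add[OF that zero(2)] by simp
  have range_e: "e * r \<in> S" for r
    using decomp[of r] e_add by metis
  have "e * e = e"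
    using fixes_S[OF range_e[of 1]] by simp
  moreover have "image_ideal e = S"
  proof
    show "image_ideal e \<subseteq> S"
      unfolding image_ideal_def using range_e by blast
    show "S \<subseteq> image_ideal e"
      unfolding image_ideal_def by (auto intro: fixes_S[symmetric])
  qed
  moreover have "rann e = T"
  proof
    show "rann e \<subseteq> T"
    proof
      fix r assume "r \<in> rann e"
      then have "e * r = 0"
        by (simp add: rann_def)
      moreover obtain s t where "s \<in> S" "t \<in> T" "r = s + t"
        using decomp by blast
      ultimately show "r \<in> T"
        using e_add by (metis add_0)
    qed
    show "T \<subseteq> rann e"
      unfolding rann_def using e_add[OF zero(1)] by auto
  qed
  ultimately show "e * e = e \<and> image_ideal e = S \<and> rann e = T"
    by blast
next
  assume e: "e * e = e \<and> image_ideal e = S \<and> rann e = T"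
  then have ST: "ring_direct_sum S T"
    using idempotent_direct_sum by metis
  have "e * s = s" if "s \<in> S" for s
    using that e unfolding image_ideal_def by (auto simp: mult.assoc[symmetric])
  moreover have "e * t = 0" if "t \<in> T" for t
    using that e unfolding rann_def by blast
  ultimately have "left_mult e = proj_along S T"
    using left_mult_eq_proj_alongI S T ST right_ideal_add_subgroup by metis
  with ST show "ring_direct_sum S T \<and> left_mult e = proj_along S T"
    by blast
qed

section \<open>Idempotents coming from inner inverses\<close>

text \<open>The equation \<open>axa = a\<close> already fixes one of the two ideals attached to each of the idempotents
  \<open>ax\<close> and \<open>xa\<close>. In the converse direction \<open>a \<in> axR\<close> is fixed by the idempotent \<open>ax\<close>.\<close>

lemma inner_inverse_iff_left_idempotent:
  fixes a x :: "'a::ring_1"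
  shows "x \<in> inner_inverses a \<longleftrightarrow>
    (a * x) * (a * x) = a * x \<and> image_ideal (a * x) = image_ideal a"
proof
  assume "x \<in> inner_inverses a"
  then have axa: "a * x * a = a"
    by (simp add: inner_inverses_def)
  have "image_ideal a \<subseteq> image_ideal (a * x)"
    unfolding image_ideal_def using axa by auto (metis mult.assoc)
  moreover have "image_ideal (a * x) \<subseteq> image_ideal a"
    unfolding image_ideal_def by (auto simp: mult.assoc)
  moreover have "(a * x) * (a * x) = a * x"
    using axa by (metis mult.assoc)
  ultimately show "(a * x) * (a * x) = a * x \<and> image_ideal (a * x) = image_ideal a"
    by blast
next
  assume idem: "(a * x) * (a * x) = a * x \<and> image_ideal (a * x) = image_ideal a"
  then obtain r where "a = a * x * r"
    using self_mem_image_ideal[of a] unfolding image_ideal_def by blast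
  then have "a * x * a = a"
    using idem by (metis mult.assoc)
  then show "x \<in> inner_inverses a"
    by (simp add: inner_inverses_def)
qed

lemma inner_inverse_right_idempotent:
  fixes a x :: "'a::ring_1"
  assumes "x \<in> inner_inverses a"
  shows "(x * a) * (x * a) = x * a" and "rann (x * a) = rann a"
proof -
  have axa: "a * (x * (a * r)) = a * r" for r
    using assms unfolding inner_inverses_def by (metis (mono_tags) mem_Collect_eq mult.assoc)
  show "(x * a) * (x * a) = x * a"
    using axa[of 1] by (simp add: mult.assoc)
  show "rann (x * a) = rann a"
    unfolding rann_def by (auto simp: mult.assoc) (metis axa mult_zero_right)
qed

text \<open>Here \<open>abq = q\<close> because \<open>ab\<close> fixes \<open>aR\<close>, which contains \<open>q\<close>; and \<open>pba = p\<close> because \<open>ba - 1\<close>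
  lies in \<open>rann a\<close>, which \<open>p\<close> kills. The term with \<open>y\<close> disappears since \<open>a(1 - ba) = 0\<close> and
  \<open>(1 - ab)a = 0\<close>.\<close>

lemma particular_solution_plus_homogeneous:
  fixes a b p q y :: "'a::ring_1"
  assumes b: "b \<in> inner_inverses a"
    and p: "p * p = p" "rann p = rann a" and q: "q * q = q" "image_ideal q = image_ideal a"
  defines "x \<equiv> p * b * q + (1 - b * a) * y * (1 - a * b)"
  shows "a * x = q" and "x * a = p"
proof -
  have aba: "a * b * a = a"
    using b by (simp add: inner_inverses_def)
  have ap: "a * p = a"
  proof -
    have "1 - p \<in> rann a"
      unfolding p(2)[symmetric] by (simp add: rann_def right_diff_distrib p(1))
    then show ?thesis
      by (simp add: rann_def right_diff_distrib)
  qed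
  have qa: "q * a = a"
  proof -
    have "a \<in> image_ideal q"
      unfolding q(2) by (rule self_mem_image_ideal)
    then show ?thesis
      unfolding image_ideal_def by (auto simp: mult.assoc[symmetric] q(1))
  qed
  have abq: "a * b * q = q"
  proof -
    have "q \<in> image_ideal a"
      unfolding q(2)[symmetric] by (rule self_mem_image_ideal)
    then show ?thesis
      unfolding image_ideal_def by (auto simp: mult.assoc[symmetric] aba)
  qed
  have pba: "p * b * a = p"
  proof -
    have "b * a - 1 \<in> rann p"
      unfolding p(2) by (simp add: rann_def right_diff_distrib mult.assoc[symmetric] aba)
    then show ?thesis
      by (simp add: rann_def right_diff_distrib mult.assoc[symmetric])
  qed
  have left_zero: "a * (1 - b * a) = 0"
    by (simp add: right_diff_distrib mult.assoc[symmetric] aba)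
  have right_zero: "(1 - a * b) * a = 0"
    by (simp add: left_diff_distrib aba)
  have "a * x = (a * p) * b * q + (a * (1 - b * a)) * y * (1 - a * b)"
    unfolding x_def by (simp only: distrib_left mult.assoc)
  then show "a * x = q"
    by (simp only: left_zero ap abq mult_zero_left add_0_right)
  have "x * a = p * b * (q * a) + (1 - b * a) * y * ((1 - a * b) * a)"
    unfolding x_def by (simp only: distrib_right mult.assoc)
  then show "x * a = p"
    by (simp only: right_zero qa pba mult_zero_right add_0_right)
qed

section \<open>Inner inverses with prescribed range and null ideal\<close>

theorem theorem4p1:
  fixes a x :: "'a::ring_1" and S T :: "'a set"
  assumes "right_ideal S" and "right_ideal T"
  defines "cond1 \<equiv>
      x \<in> inner_inverses a \<and> image_ideal (x * a) = S \<and> rann (a * x) = T"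
    and "cond2 \<equiv>
      ring_direct_sum (image_ideal a) T \<and> ring_direct_sum S (rann a) \<and>
      left_mult (a * x) = proj_along (image_ideal a) T \<and>
      left_mult (x * a) = proj_along S (rann a)"
    and "cond3 \<equiv>
      ring_direct_sum (image_ideal a) T \<and> ring_direct_sum S (rann a) \<and>
      (\<exists>b \<in> inner_inverses a. \<exists>y.
        x = proj_along S (rann a) 1 * b * proj_along (image_ideal a) T 1
            + (1 - b * a) * y * (1 - a * b))"
  shows "(cond1 \<longleftrightarrow> cond2) \<and> (cond2 \<longleftrightarrow> cond3)"
proof -
  define p where "p = proj_along S (rann a) 1"
  define q where "q = proj_along (image_ideal a) T 1"
  note iff_q = left_mult_eq_proj_along_iff[OF right_ideal_image_ideal[of a] assms(2)]
  note iff_p = left_mult_eq_proj_along_iff[OF assms(1) right_ideal_rann[of a]]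
  have cond1_iff_cond2: "cond1 \<longleftrightarrow> cond2"
  proof -
    have "cond2 \<longleftrightarrow>
        ((a * x) * (a * x) = a * x \<and> image_ideal (a * x) = image_ideal a \<and> rann (a * x) = T) \<and>
        ((x * a) * (x * a) = x * a \<and> image_ideal (x * a) = S \<and> rann (x * a) = rann a)"
      unfolding cond2_def iff_q[symmetric] iff_p[symmetric] by blast
    then show ?thesis
      unfolding cond1_def inner_inverse_iff_left_idempotent
      using inner_inverse_right_idempotent[of x a, unfolded inner_inverse_iff_left_idempotent]
      by blast
  qed
  have "cond3" if cond2
  proof -
    have inner: "a * x * a = a"
      using that cond1_iff_cond2 unfolding cond1_def inner_inverses_def by blast
    have "p = x * a" "q = a * x"
      using that unfolding cond2_def p_def q_def by (metis left_mult_def mult_1_right)+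
    moreover have "x = (x * a) * x * (a * x) + (1 - x * a) * x * (1 - a * x)"
    proof -
      have "(x * a) * x * (a * x) = x * a * x"
        using inner by (metis mult.assoc)
      then show ?thesis
        by (simp add: left_diff_distrib right_diff_distrib mult.assoc)
    qed
    ultimately have "x = p * x * q + (1 - x * a) * x * (1 - a * x)"
      by simp
    then show ?thesis
      using that inner unfolding cond2_def cond3_def p_def q_def inner_inverses_def by blast
  qed
  moreover have "cond2" if third: cond3
  proof -
    have sums: "ring_direct_sum (image_ideal a) T" "ring_direct_sum S (rann a)"
      using third unfolding cond3_def by blast+
    have q: "left_mult q = proj_along (image_ideal a) T"
      unfolding q_def
      by (rule proj_along_eq_left_mult[OF right_ideal_image_ideal assms(2) sums(1), symmetric])
    have p: "left_mult p = proj_along S (rann a)"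
      unfolding p_def
      by (rule proj_along_eq_left_mult[OF assms(1) right_ideal_rann sums(2), symmetric])
    obtain b y where b: "b \<in> inner_inverses a"
      and x: "x = p * b * q + (1 - b * a) * y * (1 - a * b)"
      using third unfolding cond3_def p_def q_def by blast
    have "p * p = p" "rann p = rann a" "q * q = q" "image_ideal q = image_ideal a"
      using iff_p[of p] iff_q[of q] p q sums by blast+
    then have "a * x = q" "x * a = p"
      unfolding x using particular_solution_plus_homogeneous[OF b] by blast+
    then show ?thesis
      unfolding cond2_def using p q sums by simp
  qed
  ultimately show ?thesis
    using cond1_iff_cond2 by blast
qed

end
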